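(* Let $\langle K,R\rangle$ be a Kripke frame. The axiom scheme $[\varphi\rightarrow(\psi\rightarrow\theta)]\rightarrow[(\varphi\&\psi)\rightarrow\theta]$ is satisfied in $\langle K,R\rangle$ (every instance, for all formulas $\varphi,\psi,\theta$, holds at every node of every Kripke model on this frame) if and only if for every $k\in K$ and every $x\in R^2[k]$ we have $xRx$.
   Context: Formulas are built from a countably infinite set of atoms and the constant $\bot$ (falsity) using the binary connectives $\&$ and $\rightarrow$. A Kripke frame is a pair $\langle K,R\rangle$ with $R\subseteq K\times K$ an arbitrary binary relation; a Kripke model on it is $\langle K,R,\vDash\rangle$ with $\vDash\subseteq K\times\mathsf{Atoms}$ arbitrary, extended to formulas by: $k\nvDash\bot$; $k\vDash\varphi\&\psi$ iff $k\vDash\varphi$ and $k\vDash\psi$; $k\vDash\varphi\rightarrow\psi$ iff for every $k'$ with $kRk'$, if $k'\vDash\varphi$ then $k'\vDash\psi$. For $k\in K$, $R^2[k]=\{x\mid \exists y\,(kRy \text{ and } yRx)\}$. *)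

theory Defs
  imports Main
begin

text \<open>Atoms are indexed by the natural numbers, so there are countably infinitely many of them.\<close>

datatype form =
    Atom nat
  | Falsum  (\<open>\<^bold>\<bottom>\<close>)
  | And form form  (infixr \<open>\<^bold>&\<close> 65)
  | Imp form form  (infixr \<open>\<^bold>\<rightarrow>\<close> 60)

text \<open>The relation of a frame is arbitrary: no reflexivity, transitivity, or persistence of atoms
  is required.\<close>

definition kripke_frame :: "'w set \<Rightarrow> ('w \<times> 'w) set \<Rightarrow> bool" where
  "kripke_frame K R \<longleftrightarrow> R \<subseteq> K \<times> K"

definition kripke_model :: "'w set \<Rightarrow> ('w \<times> 'w) set \<Rightarrow> ('w \<times> nat) set \<Rightarrow> bool" where
  "kripke_model K R V \<longleftrightarrow> kripke_frame K R \<and> V \<subseteq> K \<times> UNIV"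

primrec sat :: "'w set \<Rightarrow> ('w \<times> 'w) set \<Rightarrow> ('w \<times> nat) set \<Rightarrow> 'w \<Rightarrow> form \<Rightarrow> bool" where
  "sat K R V k (Atom p) \<longleftrightarrow> (k, p) \<in> V"
| "sat K R V k \<^bold>\<bottom> \<longleftrightarrow> False"
| "sat K R V k (\<phi> \<^bold>& \<psi>) \<longleftrightarrow> sat K R V k \<phi> \<and> sat K R V k \<psi>"
| "sat K R V k (\<phi> \<^bold>\<rightarrow> \<psi>) \<longleftrightarrow>
    (\<forall>k'\<in>K. (k, k') \<in> R \<longrightarrow> sat K R V k' \<phi> \<longrightarrow> sat K R V k' \<psi>)"

definition satisfied_in_frame :: "'w set \<Rightarrow> ('w \<times> 'w) set \<Rightarrow> form \<Rightarrow> bool" where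
  "satisfied_in_frame K R \<chi> \<longleftrightarrow> (\<forall>V. kripke_model K R V \<longrightarrow> (\<forall>k\<in>K. sat K R V k \<chi>))"

definition R2 :: "('w \<times> 'w) set \<Rightarrow> 'w \<Rightarrow> 'w set" where
  "R2 R k = {x. \<exists>y. (k, y) \<in> R \<and> (y, x) \<in> R}"

end

theory Submission
  imports Defs
begin

theorem theorem4:
  fixes K :: "'w set" and R :: "('w \<times> 'w) set"
  assumes "kripke_frame K R"
  shows "(\<forall>\<phi> \<psi> \<theta>. satisfied_in_frame K R
            ((\<phi> \<^bold>\<rightarrow> (\<psi> \<^bold>\<rightarrow> \<theta>)) \<^bold>\<rightarrow> ((\<phi> \<^bold>& \<psi>) \<^bold>\<rightarrow> \<theta>)))
         \<longleftrightarrow> (\<forall>k\<in>K. \<forall>x\<in>R2 R k. (x, x) \<in> R)"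
    (is "?valid \<longleftrightarrow> ?refl")
proof
  assume valid: ?valid
  show ?refl
  proof (intro ballI)
    fix k x
    assume k: "k \<in> K" and "x \<in> R2 R k"
    then obtain y where y: "(k, y) \<in> R" "(y, x) \<in> R"
      by (auto simp: R2_def)
    with assms have K: "y \<in> K" "x \<in> K"
      by (auto simp: kripke_frame_def)
    \<comment> \<open>If \<open>x\<close> is irreflexive and \<open>p\<close> holds at \<open>x\<close> only, then \<open>p \<rightarrow> (p \<rightarrow> \<bottom>)\<close> holds everywhere,
      whereas \<open>p & p \<rightarrow> \<bottom>\<close> fails at \<open>y\<close>.\<close>
    let ?V = "{(x, 0)}" and ?p = "Atom 0"
    have "kripke_model K R ?V"
      using assms K by (simp add: kripke_model_def)
    with valid k have
      "sat K R ?V k ((?p \<^bold>\<rightarrow> (?p \<^bold>\<rightarrow> \<^bold>\<bottom>)) \<^bold>\<rightarrow> ((?p \<^bold>& ?p) \<^bold>\<rightarrow> \<^bold>\<bottom>))"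
      unfolding satisfied_in_frame_def by blast
    with y K show "(x, x) \<in> R"
      by auto
  qed
next
  assume refl: ?refl
  \<comment> \<open>This is what the scheme demands at \<open>k\<close> once its main implication
    and the one in its consequent are unfolded: \<open>y\<close> is the successor for the former,
    \<open>x\<close> the successor of \<open>y\<close> for the latter.\<close>
  have "sat K R V x \<theta>"
    if "k \<in> K" "(k, y) \<in> R" "(y, x) \<in> R" "x \<in> K"
      and "sat K R V y (\<phi> \<^bold>\<rightarrow> (\<psi> \<^bold>\<rightarrow> \<theta>))" "sat K R V x \<phi>" "sat K R V x \<psi>"
    for V k y x \<phi> \<psi> \<theta>
  proof -
    have "(x, x) \<in> R"
      using refl that by (auto simp: R2_def)
    with that show ?thesis
      by simp
  qed
  then show ?valid
    unfolding satisfied_in_frame_def sat.simps(3,4) by blast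
qed

end
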